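(* Let $X$ be a shift of finite type and let $\phi$ be a right continuing code from $X$ onto a shift space $Y$. Then $Y$ is a shift of finite type.
   Context: A shift space over a finite alphabet $A$ is a closed shift-invariant subset of $A^{\mathbb{Z}}$; $\sigma$ denotes the shift map, $(\sigma x)_i=x_{i+1}$. A shift of finite type (SFT) is a shift space determined by a finite set of forbidden words. A (sliding) block code between shift spaces is a continuous map commuting with the shift maps. Two points $x,x'$ of a shift space are left asymptotic if there is $n\in\mathbb{Z}$ with $x_i=x'_i$ for all $i\le n$. A block code $\phi$ from a shift space $X$ onto a shift space $Y$ is right continuing if for each $x\in X$ and $y\in Y$ such that $\phi(x)$ is left asymptotic to $y$, there is at least one $\bar x\in X$ such that $\bar x$ is left asymptotic to $x$ and $\phi(\bar x)=y$. *)

theory Defs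
  imports "HOL-Analysis.Analysis"
begin

text \<open>Bi-infinite sequences over an alphabet are functions on \<open>int\<close>; the alphabet \<open>A\<close> is an
  explicit set, so that \<open>A\<^sup>\<int>\<close> is the topological space below, with underlying set
  \<open>{x. \<forall>i. x i \<in> A}\<close>.\<close>

definition full_shift_topology :: "'a set \<Rightarrow> (int \<Rightarrow> 'a) topology" where
  "full_shift_topology A = product_topology (\<lambda>_. discrete_topology A) UNIV"

definition shift :: "(int \<Rightarrow> 'a) \<Rightarrow> (int \<Rightarrow> 'a)" where
  "shift x = (\<lambda>i. x (i + 1))"

text \<open>Shift-invariance is meant two-sidedly, \<open>\<sigma>(X) = X\<close>. The empty set is a shift space.\<close>

definition shift_space :: "'a set \<Rightarrow> (int \<Rightarrow> 'a) set \<Rightarrow> bool" where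
  "shift_space A X \<longleftrightarrow>
     finite A \<and> closedin (full_shift_topology A) X \<and> shift ` X = X"

definition occurs_in :: "'a list \<Rightarrow> (int \<Rightarrow> 'a) \<Rightarrow> bool" where
  "occurs_in w x \<longleftrightarrow> (\<exists>i. \<forall>k < length w. x (i + int k) = w ! k)"

definition avoiding :: "'a set \<Rightarrow> 'a list set \<Rightarrow> (int \<Rightarrow> 'a) set" where
  "avoiding A F = {x. (\<forall>i. x i \<in> A) \<and> (\<forall>w \<in> F. \<not> occurs_in w x)}"

definition shift_of_finite_type :: "'a set \<Rightarrow> (int \<Rightarrow> 'a) set \<Rightarrow> bool" where
  "shift_of_finite_type A X \<longleftrightarrow>
     shift_space A X \<and> (\<exists>F. finite F \<and> F \<subseteq> lists A \<and> X = avoiding A F)"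

text \<open>Only the values of \<open>\<phi>\<close> on \<open>X\<close> matter.\<close>

definition block_code ::
  "'a set \<Rightarrow> (int \<Rightarrow> 'a) set \<Rightarrow> 'b set \<Rightarrow> (int \<Rightarrow> 'b) set \<Rightarrow> ((int \<Rightarrow> 'a) \<Rightarrow> (int \<Rightarrow> 'b)) \<Rightarrow> bool" where
  "block_code A X B Y \<phi> \<longleftrightarrow>
     continuous_map (subtopology (full_shift_topology A) X)
                    (subtopology (full_shift_topology B) Y) \<phi> \<and>
     (\<forall>x \<in> X. \<phi> (shift x) = shift (\<phi> x))"

definition left_asymptotic :: "(int \<Rightarrow> 'a) \<Rightarrow> (int \<Rightarrow> 'a) \<Rightarrow> bool" where
  "left_asymptotic x x' \<longleftrightarrow> (\<exists>n. \<forall>i \<le> n. x i = x' i)"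

definition right_continuing ::
  "'a set \<Rightarrow> (int \<Rightarrow> 'a) set \<Rightarrow> 'b set \<Rightarrow> (int \<Rightarrow> 'b) set \<Rightarrow> ((int \<Rightarrow> 'a) \<Rightarrow> (int \<Rightarrow> 'b)) \<Rightarrow> bool" where
  "right_continuing A X B Y \<phi> \<longleftrightarrow>
     block_code A X B Y \<phi> \<and> \<phi> ` X = Y \<and>
     (\<forall>x \<in> X. \<forall>y \<in> Y. left_asymptotic (\<phi> x) y \<longrightarrow>
        (\<exists>x' \<in> X. left_asymptotic x' x \<and> \<phi> x' = y))"

end

theory Submission
  imports Defs
begin

text \<open>For a point \<open>y\<close> of \<open>Y\<close> consider its follower set: all \<open>z\<close> whose positive half may be attached
  to the nonpositive half of \<open>y\<close> without leaving \<open>Y\<close>. If follower sets are determined by a central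
  window \<open>[-N, N]\<close>, then two points of \<open>Y\<close> agreeing there can be cut at the origin and recombined,
  since each point follows its own past; this recombination property makes \<open>Y\<close> of finite type
  (\<open>finite_type_if_gluing\<close>). By compactness it is enough that \<open>y \<mapsto> followers Y y\<close> is locally
  constant on \<open>Y\<close>, and since \<open>\<phi>\<close> is a quotient map (\<open>X\<close> is compact, \<open>Y\<close> is Hausdorff), that
  \<open>x \<mapsto> followers Y (\<phi> x)\<close> is locally constant on \<open>X\<close>.

  Let \<open>x'\<close> in \<open>X\<close> be close to \<open>x\<close>. Because \<open>X\<close> is of finite type, a follower set is determined by
  the set of central words of \<open>X\<close> at which preimages of the past can end (\<open>followers_via_states\<close>), so
  there are only finitely many follower sets. As \<open>Y\<close> is closed, limits of followers are followers
  of the limit, and finiteness turns this into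
  \<open>followers Y (\<phi> x') \<subseteq> followers Y (\<phi> x)\<close> (\<open>followers_upper\<close>). The reverse inclusion
  (\<open>followers_lower\<close>) is where right continuation enters: each follower of \<open>\<phi> x\<close> lifts to a point
  left asymptotic to \<open>x\<close>. How far to the left the lift departs from \<open>x\<close> depends on the follower,
  but only its state at the origin matters, and there are finitely many states; hence finitely many
  lifts suffice. They depart from \<open>x\<close> inside a bounded window, and can be
  attached to every \<open>x'\<close> that agrees with \<open>x\<close> on that window.\<close>

section \<open>Shift spaces in terms of central windows\<close>

definition agree :: "int \<Rightarrow> (int \<Rightarrow> 'a) \<Rightarrow> (int \<Rightarrow> 'a) \<Rightarrow> bool" where
  "agree N x y \<longleftrightarrow> (\<forall>i\<in>{-N..N}. x i = y i)"

lemma agree_trans: "agree N x y \<Longrightarrow> agree N y z \<Longrightarrow> agree N x z"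
  by (simp add: agree_def)

lemma agree_mono: "agree N x y \<Longrightarrow> M \<le> N \<Longrightarrow> agree M x y"
  by (simp add: agree_def)

lemma topspace_full_shift: "topspace (full_shift_topology A) = {x. \<forall>i. x i \<in> A}"
  by (auto simp: full_shift_topology_def PiE_def Pi_def)

lemma shift_space_alphabet: "shift_space A X \<Longrightarrow> x \<in> X \<Longrightarrow> x i \<in> A"
  using closedin_subset[of "full_shift_topology A" X]
  by (auto simp: shift_space_def topspace_full_shift)

lemma topspace_shift_space:
  "shift_space A X \<Longrightarrow> topspace (subtopology (full_shift_topology A) X) = X"
  using closedin_subset by (fastforce simp: shift_space_def)

text \<open>A basic open set of the product constrains finitely many coordinates only, so central windows
  are fine enough to describe the topology.\<close>

lemma openin_full_shift_window:
  assumes "openin (full_shift_topology A) U" "x \<in> U"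
  obtains N where "\<And>y. (\<And>i. y i \<in> A) \<Longrightarrow> agree N x y \<Longrightarrow> y \<in> U"
proof -
  obtain V where V: "x \<in> (\<Pi>\<^sub>E i\<in>UNIV. V i)" "finite {i. V i \<noteq> A}" "(\<Pi>\<^sub>E i\<in>UNIV. V i) \<subseteq> U"
    using product_topology_open_contains_basis[OF assms[unfolded full_shift_topology_def]]
    by auto
  define N where "N = Max (insert 0 (abs ` {i. V i \<noteq> A}))"
  have N: "\<bar>i\<bar> \<le> N" if "V i \<noteq> A" for i
    unfolding N_def using V(2) that by (intro Max_ge) auto
  have "y \<in> U" if y: "\<And>i. y i \<in> A" "agree N x y" for y
  proof -
    have "y i \<in> V i" for i
    proof (cases "V i = A")
      case False
      then have "y i = x i"
        using N[of i] y(2) by (auto simp: agree_def abs_le_iff)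
      then show ?thesis using V(1) by (auto simp: PiE_def Pi_def)
    qed (use y in auto)
    then show ?thesis using V(3) by (auto simp: PiE_def Pi_def)
  qed
  then show ?thesis using that by blast
qed

lemma openin_window: "openin (full_shift_topology A) {y. (\<forall>i. y i \<in> A) \<and> agree N x y}"
proof -
  define V where "V i = (if i \<in> {-N..N} then A \<inter> {x i} else A)" for i
  have "openin (full_shift_topology A) (PiE UNIV V)"
    unfolding full_shift_topology_def openin_PiE_gen
  proof (intro disjI2 conjI)
    have "{i \<in> UNIV. V i \<noteq> topspace (discrete_topology A)} \<subseteq> {-N..N}"
      by (auto simp: V_def split: if_splits)
    then show "finite {i \<in> UNIV. V i \<noteq> topspace (discrete_topology A)}"
      by (rule finite_subset) auto
  qed (auto simp: V_def)
  moreover have "PiE UNIV V = {y. (\<forall>i. y i \<in> A) \<and> agree N x y}"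
    by (fastforce simp: V_def PiE_def Pi_def agree_def split: if_splits)
  ultimately show ?thesis by simp
qed

lemma openin_shift_space_iff:
  assumes "shift_space A X"
  shows "openin (subtopology (full_shift_topology A) X) U \<longleftrightarrow>
    U \<subseteq> X \<and> (\<forall>x\<in>U. \<exists>N. \<forall>y\<in>X. agree N x y \<longrightarrow> y \<in> U)" (is "?L \<longleftrightarrow> ?R")
proof
  assume ?L
  then obtain T where T: "openin (full_shift_topology A) T" "U = T \<inter> X"
    by (auto simp: openin_subtopology)
  have "\<exists>N. \<forall>y\<in>X. agree N x y \<longrightarrow> y \<in> U" if x: "x \<in> U" for x
  proof -
    have "x \<in> T" using x T(2) by simp
    then obtain N where "\<And>y. (\<And>i. y i \<in> A) \<Longrightarrow> agree N x y \<Longrightarrow> y \<in> T"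
      using openin_full_shift_window[OF T(1)] by blast
    then show ?thesis using T(2) shift_space_alphabet[OF assms] by blast
  qed
  then show ?R using T(2) by auto
next
  assume R: ?R
  show ?L
  proof (subst openin_subopen, intro ballI)
    fix x assume x: "x \<in> U"
    then obtain N where N: "\<forall>y\<in>X. agree N x y \<longrightarrow> y \<in> U" using R by blast
    let ?T = "{y. (\<forall>i. y i \<in> A) \<and> agree N x y} \<inter> X"
    have "openin (subtopology (full_shift_topology A) X) ?T"
      using openin_window openin_subtopology by blast
    moreover have "x \<in> ?T"
      using x R shift_space_alphabet[OF assms] by (auto simp: agree_def)
    moreover have "?T \<subseteq> U" using N by auto
    ultimately show "\<exists>T. openin (subtopology (full_shift_topology A) X) T \<and> x \<in> T \<and> T \<subseteq> U"
      by blast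
  qed
qed

lemma shift_space_limit:
  assumes X: "shift_space A X" and x: "\<And>i. x i \<in> A" and app: "\<And>N. \<exists>y\<in>X. agree N x y"
  shows "x \<in> X"
proof (rule ccontr)
  assume "x \<notin> X"
  have "openin (full_shift_topology A) (topspace (full_shift_topology A) - X)"
    using X by (auto simp: shift_space_def)
  then obtain N where N: "\<And>y. (\<And>i. y i \<in> A) \<Longrightarrow> agree N x y \<Longrightarrow>
      y \<in> topspace (full_shift_topology A) - X"
    using openin_full_shift_window[of A "topspace (full_shift_topology A) - X" x] x \<open>x \<notin> X\<close>
    by (auto simp: topspace_full_shift)
  then show False using app[of N] shift_space_alphabet[OF X] by blast
qed

lemma compact_shift_space:
  assumes "shift_space A X"
  shows "compact_space (subtopology (full_shift_topology A) X)"
proof (rule compact_space_subtopology, rule closedin_compact_space)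
  show "compact_space (full_shift_topology A)"
    using assms unfolding full_shift_topology_def shift_space_def
    by (simp add: compact_space_product_topology compact_space_discrete_topology)
  show "closedin (full_shift_topology A) X"
    using assms by (simp add: shift_space_def)
qed

lemma Hausdorff_shift_space: "Hausdorff_space (subtopology (full_shift_topology A) X)"
  unfolding full_shift_topology_def
  by (intro Hausdorff_space_subtopology) (simp add: Hausdorff_space_product_topology)

definition locally_constant :: "(int \<Rightarrow> 'a) set \<Rightarrow> ((int \<Rightarrow> 'a) \<Rightarrow> 'c) \<Rightarrow> bool" where
  "locally_constant X g \<longleftrightarrow> (\<forall>x\<in>X. \<exists>N. \<forall>y\<in>X. agree N x y \<longrightarrow> g y = g x)"

lemma locally_constant_iff_continuous:
  assumes X: "shift_space A X"
  shows "locally_constant X g \<longleftrightarrow>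
    continuous_map (subtopology (full_shift_topology A) X) (discrete_topology UNIV) g"
proof
  assume "locally_constant X g"
  then show "continuous_map (subtopology (full_shift_topology A) X) (discrete_topology UNIV) g"
    unfolding continuous_map_def openin_shift_space_iff[OF X] topspace_shift_space[OF X]
    by (fastforce simp: locally_constant_def)
next
  assume c: "continuous_map (subtopology (full_shift_topology A) X) (discrete_topology UNIV) g"
  show "locally_constant X g"
    unfolding locally_constant_def
  proof
    fix x assume "x \<in> X"
    moreover have "openin (subtopology (full_shift_topology A) X) {y \<in> X. g y \<in> {g x}}"
      using openin_continuous_map_preimage[OF c, of "{g x}"] by (simp only: topspace_shift_space[OF X] openin_discrete_topology subset_UNIV)
    ultimately show "\<exists>N. \<forall>y\<in>X. agree N x y \<longrightarrow> g y = g x"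
      unfolding openin_shift_space_iff[OF X] by auto
  qed
qed

text \<open>A Lebesgue number argument: finitely many windows of constancy cover \<open>X\<close>, and the widest of
  them works everywhere.\<close>

lemma locally_constant_uniform:
  assumes X: "shift_space A X" and g: "locally_constant X g"
  obtains N where "0 \<le> N" "\<And>x y. x \<in> X \<Longrightarrow> y \<in> X \<Longrightarrow> agree N x y \<Longrightarrow> g x = g y"
proof -
  let ?T = "subtopology (full_shift_topology A) X"
  obtain n where n: "\<And>x y. x \<in> X \<Longrightarrow> y \<in> X \<Longrightarrow> agree (n x) x y \<Longrightarrow> g y = g x"
    using g unfolding locally_constant_def by metis
  define C where "C x = {y \<in> X. agree (n x) x y}" for x
  have "openin ?T (C x)" for x
    unfolding openin_shift_space_iff[OF X] C_def by (blast intro: agree_trans)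
  moreover have "X \<subseteq> (\<Union>x\<in>X. C x)"
    by (auto simp: C_def agree_def)
  ultimately obtain \<F> where "finite \<F>" "\<F> \<subseteq> C ` X" "X \<subseteq> \<Union>\<F>"
    using compactinD[of ?T X "C ` X"] compact_shift_space[OF X]
    unfolding compact_space_def topspace_shift_space[OF X] by blast
  then obtain D where D: "finite D" "D \<subseteq> X" "X \<subseteq> (\<Union>x\<in>D. C x)"
    by (metis finite_subset_image)
  define N where "N = Max (insert 0 (n ` D))"
  have N: "n d \<le> N" if "d \<in> D" for d
    unfolding N_def using D(1) that by (intro Max_ge) auto
  have "g x = g y" if xy: "x \<in> X" "y \<in> X" "agree N x y" for x y
  proof -
    obtain d where d: "d \<in> D" "agree (n d) d x" using D(3) xy(1) by (auto simp: C_def)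
    then have "agree (n d) d y" using agree_mono[OF xy(3) N] agree_trans by blast
    then show ?thesis using n[of d x] n[of d y] d D(2) xy by auto
  qed
  moreover have "0 \<le> N" unfolding N_def using D(1) by (intro Max_ge) auto
  ultimately show ?thesis using that by blast
qed

text \<open>A continuous surjection from a compact space to a Hausdorff space is a quotient map, so
  continuity into a discrete space can be tested after composing with it.\<close>

lemma locally_constant_push_forward:
  assumes X: "shift_space A X" and Y: "shift_space B Y"
    and c: "continuous_map (subtopology (full_shift_topology A) X)
                           (subtopology (full_shift_topology B) Y) \<phi>"
    and onto: "\<phi> ` X = Y" and g: "locally_constant X (g \<circ> \<phi>)"
  shows "locally_constant Y g"
proof -
  have "quotient_map (subtopology (full_shift_topology A) X)
                     (subtopology (full_shift_topology B) Y) \<phi>"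
    using c onto compact_shift_space[OF X] Hausdorff_imp_kc_space[OF Hausdorff_shift_space]
    by (intro continuous_closed_imp_quotient_map continuous_imp_closed_map_gen)
      (simp_all only: topspace_shift_space[OF X] topspace_shift_space[OF Y])
  then show ?thesis
    using g continuous_compose_quotient_map
    unfolding locally_constant_iff_continuous[OF X] locally_constant_iff_continuous[OF Y]
    by blast
qed

section \<open>Translation and sliding blocks\<close>

definition translate :: "int \<Rightarrow> (int \<Rightarrow> 'a) \<Rightarrow> (int \<Rightarrow> 'a)" where
  "translate k x = (\<lambda>i. x (i + k))"

lemma shift_translate: "shift (translate k x) = translate (k + 1) x"
  by (simp add: shift_def translate_def algebra_simps)

lemma translate_in_shift_space:
  assumes X: "shift_space A X" and x: "x \<in> X"
  shows "translate k x \<in> X"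
proof (induction k rule: int_induct[where k=0])
  case base
  then show ?case using x by (simp add: translate_def)
next
  case (step1 i)
  then show ?case using X by (auto simp: shift_space_def simp flip: shift_translate)
next
  case (step2 i)
  then obtain y where "y \<in> X" "translate i x = shift y" using X by (auto simp: shift_space_def)
  then have "translate (i - 1) x = y"
    by (auto simp: shift_def translate_def fun_eq_iff algebra_simps)
      (metis add.commute diff_add_cancel diff_add_eq)
  then show ?case using \<open>y \<in> X\<close> by simp
qed

lemma block_code_translate:
  assumes X: "shift_space A X" and c: "block_code A X B Y \<phi>" and x: "x \<in> X"
  shows "\<phi> (translate k x) = translate k (\<phi> x)"
proof (induction k rule: int_induct[where k=0])
  case base
  then show ?case by (simp add: translate_def)
next
  case (step1 i)
  then show ?case
    using c translate_in_shift_space[OF X x] by (metis block_code_def shift_translate)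
next
  case (step2 i)
  have "shift (\<phi> (translate (i - 1) x)) = \<phi> (shift (translate (i - 1) x))"
    using c translate_in_shift_space[OF X x] by (auto simp: block_code_def)
  also have "\<dots> = shift (translate (i - 1) (\<phi> x))"
    using step2 by (simp add: shift_translate)
  finally show ?case
    by (auto simp: shift_def fun_eq_iff) (metis diff_add_cancel)
qed

text \<open>The Curtis--Hedlund--Lyndon theorem: the coordinate at the origin is a locally constant function of the
  image, hence depends on a bounded window of the argument, and translation carries this to all
  coordinates.\<close>

lemma block_code_radius:
  assumes X: "shift_space A X" and Y: "shift_space B Y" and c: "block_code A X B Y \<phi>"
  obtains R where "0 \<le> R"
    "\<And>x y i. x \<in> X \<Longrightarrow> y \<in> X \<Longrightarrow> (\<And>j. i - R \<le> j \<Longrightarrow> j \<le> i + R \<Longrightarrow> x j = y j) \<Longrightarrow> \<phi> x i = \<phi> y i"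
proof -
  have "locally_constant X (\<lambda>x. \<phi> x 0)"
  proof -
    have "locally_constant Y (\<lambda>y. y 0)"
      unfolding locally_constant_def agree_def by (intro ballI exI[of _ 0]) auto
    then have "continuous_map (subtopology (full_shift_topology A) X) (discrete_topology UNIV)
        ((\<lambda>y. y 0) \<circ> \<phi>)"
      unfolding locally_constant_iff_continuous[OF Y]
      using c by (auto simp: block_code_def intro: continuous_map_compose)
    then show ?thesis by (simp add: locally_constant_iff_continuous[OF X] o_def)
  qed
  then obtain R where R: "0 \<le> R" "\<And>x y. x \<in> X \<Longrightarrow> y \<in> X \<Longrightarrow> agree R x y \<Longrightarrow> \<phi> x 0 = \<phi> y 0"
    using locally_constant_uniform[OF X] by metis
  have "\<phi> x i = \<phi> y i"
    if "x \<in> X" "y \<in> X" "\<And>j. i - R \<le> j \<Longrightarrow> j \<le> i + R \<Longrightarrow> x j = y j" for x y i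
  proof -
    have "\<phi> (translate i x) 0 = \<phi> (translate i y) 0"
      using that by (intro R translate_in_shift_space[OF X]) (auto simp: agree_def translate_def)
    then show ?thesis
      by (simp add: block_code_translate[OF X c that(1)] block_code_translate[OF X c that(2)])
        (simp add: translate_def)
  qed
  then show ?thesis using that R(1) by blast
qed

section \<open>Gluing\<close>

definition glue :: "int \<Rightarrow> (int \<Rightarrow> 'a) \<Rightarrow> (int \<Rightarrow> 'a) \<Rightarrow> (int \<Rightarrow> 'a)" where
  "glue p x y = (\<lambda>i. if i \<le> p then x i else y i)"

text \<open>With \<open>M\<close> the maximal length of a forbidden word, an occurrence in the glued point lies within one
  of the two points, because both coincide on the \<open>2 * M + 1\<close> places around the cut.\<close>

lemma finite_type_gluing:
  assumes "shift_of_finite_type A X"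
  obtains M where "0 \<le> M"
    "\<And>x y p. x \<in> X \<Longrightarrow> y \<in> X \<Longrightarrow> (\<And>j. p - M \<le> j \<Longrightarrow> j \<le> p + M \<Longrightarrow> x j = y j) \<Longrightarrow> glue p x y \<in> X"
proof -
  obtain F where F: "finite F" "X = avoiding A F"
    using assms by (auto simp: shift_of_finite_type_def)
  define M where "M = int (Max (insert 0 (length ` F)))"
  have M: "int (length w) \<le> M" if "w \<in> F" for w
    unfolding M_def using F(1) that by (auto intro!: Max_ge)
  have "glue p x y \<in> X"
    if xy: "x \<in> X" "y \<in> X" and ag: "\<And>j. p - M \<le> j \<Longrightarrow> j \<le> p + M \<Longrightarrow> x j = y j" for x y p
  proof -
    have "\<not> occurs_in w (glue p x y)" if w: "w \<in> F" for w
    proof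
      assume "occurs_in w (glue p x y)"
      then obtain i where i: "\<And>k. k < length w \<Longrightarrow> glue p x y (i + int k) = w ! k"
        by (auto simp: occurs_in_def)
      \<comment> \<open>The occurrence is too short to leave the overlap on both sides.\<close>
      show False
      proof (cases "i < p - M")
        case True
        then have "x (i + int k) = w ! k" if "k < length w" for k
          using i[OF that] that M[OF w] by (auto simp: glue_def split: if_splits)
        then have "occurs_in w x" by (auto simp: occurs_in_def)
        then show False using xy F(2) w by (auto simp: avoiding_def)
      next
        case False
        then have "y (i + int k) = w ! k" if "k < length w" for k
          using i[OF that] ag[of "i + int k"] that M[OF w] by (auto simp: glue_def split: if_splits)
        then have "occurs_in w y" by (auto simp: occurs_in_def)
        then show False using xy F(2) w by (auto simp: avoiding_def)
      qed
    qed
    then show ?thesis using xy F(2) by (auto simp: avoiding_def glue_def)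
  qed
  moreover have "0 \<le> M" by (simp add: M_def)
  ultimately show ?thesis using that by blast
qed

text \<open>The forbidden words are those of length \<open>2 * N + 2\<close> that do not occur in \<open>Y\<close>. That length is chosen so
  that consecutive windows of a point avoiding them share \<open>2 * N + 1\<close> places, exactly the overlap
  needed for gluing; points of \<open>Y\<close> then match ever longer stretches of it, and closedness finishes.\<close>

lemma finite_type_if_gluing:
  assumes Y: "shift_space B Y" and N: "0 \<le> N"
    and gl: "\<And>y z. y \<in> Y \<Longrightarrow> z \<in> Y \<Longrightarrow> agree N y z \<Longrightarrow> glue 0 y z \<in> Y"
  shows "shift_of_finite_type B Y"
proof -
  have gl': "glue p y z \<in> Y"
    if yz: "y \<in> Y" "z \<in> Y" and ag: "\<And>j. p - N \<le> j \<Longrightarrow> j \<le> p + N \<Longrightarrow> y j = z j" for p y z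
  proof -
    have "glue 0 (translate p y) (translate p z) \<in> Y"
      using yz ag by (intro gl translate_in_shift_space[OF Y]) (auto simp: agree_def translate_def)
    then have "translate (-p) (glue 0 (translate p y) (translate p z)) \<in> Y"
      by (rule translate_in_shift_space[OF Y])
    also have "translate (-p) (glue 0 (translate p y) (translate p z)) = glue p y z"
      by (auto simp: translate_def glue_def fun_eq_iff)
    finally show ?thesis .
  qed
  define n where "n = nat (2 * N + 2)"
  define F where "F = {w \<in> lists B. length w = n \<and> (\<forall>y\<in>Y. \<not> occurs_in w y)}"
  have "finite B" using Y by (simp add: shift_space_def)
  then have "finite F"
    unfolding F_def by (intro finite_subset[OF _ finite_lists_length_eq[of B n]]) auto
  have "Y = avoiding B F"
  proof (intro equalityI subsetI)
    fix y assume "y \<in> Y"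
    then show "y \<in> avoiding B F"
      using shift_space_alphabet[OF Y] by (auto simp: avoiding_def F_def)
  next
    fix z assume z: "z \<in> avoiding B F"
    then have zB: "z i \<in> B" for i by (simp add: avoiding_def)
    have word: "\<exists>y\<in>Y. \<forall>i. a \<le> i \<and> i \<le> a + 2 * N + 1 \<longrightarrow> y i = z i" for a
    proof -
      let ?w = "map (\<lambda>k. z (a + int k)) [0..<n]"
      have "occurs_in ?w z" by (auto simp: occurs_in_def)
      then have "?w \<notin> F" using z by (auto simp: avoiding_def)
      moreover have "?w \<in> lists B" using zB by auto
      ultimately obtain y i where y: "y \<in> Y" "\<forall>k<n. y (i + int k) = z (a + int k)"
        by (auto simp: F_def occurs_in_def)
      \<comment> \<open>Move the occurrence of the word from \<open>i\<close> to \<open>a\<close>.\<close>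
      have "translate (i - a) y j = z j" if "a \<le> j \<and> j \<le> a + 2 * N + 1" for j
      proof -
        have "nat (j - a) < n" using that by (auto simp: n_def)
        then have "y (i + int (nat (j - a))) = z (a + int (nat (j - a)))" using y(2) by blast
        then show ?thesis using that by (simp add: translate_def algebra_simps)
      qed
      then show ?thesis using translate_in_shift_space[OF Y y(1)] by blast
    qed
    have long: "\<exists>y\<in>Y. \<forall>i. a \<le> i \<and> i \<le> a + int k + 2 * N + 1 \<longrightarrow> y i = z i" for a k
    proof (induction k)
      case 0
      then show ?case using word[of a] by simp
    next
      case (Suc k)
      then obtain y where y: "y \<in> Y" "\<And>i. a \<le> i \<Longrightarrow> i \<le> a + int k + 2 * N + 1 \<Longrightarrow> y i = z i"
        by blast
      let ?b = "a + int k + 1"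
      obtain y' where y': "y' \<in> Y" "\<And>i. ?b \<le> i \<Longrightarrow> i \<le> ?b + 2 * N + 1 \<Longrightarrow> y' i = z i"
        using word[of ?b] by blast
      have "glue (?b + N) y y' \<in> Y"
        using y y' by (intro gl') auto
      moreover have "glue (?b + N) y y' i = z i" if "a \<le> i \<and> i \<le> a + int (Suc k) + 2 * N + 1" for i
        using that y(2)[of i] y'(2)[of i] N by (auto simp: glue_def)
      ultimately show ?case by blast
    qed
    show "z \<in> Y"
    proof (rule shift_space_limit[OF Y zB])
      fix K
      obtain y where y: "y \<in> Y"
          "\<And>i. -K \<le> i \<Longrightarrow> i \<le> -K + int (nat (2 * K)) + 2 * N + 1 \<Longrightarrow> y i = z i"
        using long[of "-K" "nat (2 * K)"] by blast
      have "z i = y i" if "-K \<le> i" "i \<le> K" for i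
        using that N by (intro y(2)[symmetric]) auto
      then show "\<exists>y\<in>Y. agree K z y" using y(1) by (auto simp: agree_def)
    qed
  qed
  moreover have "F \<subseteq> lists B" by (auto simp: F_def)
  ultimately show ?thesis using Y \<open>finite F\<close> by (auto simp: shift_of_finite_type_def)
qed

section \<open>Follower sets\<close>

text \<open>Follower sets usually consist of one-sided sequences. Here each is represented by all its
  two-sided extensions, which makes every point of \<open>Y\<close> one of its own followers.\<close>

definition followers :: "(int \<Rightarrow> 'b) set \<Rightarrow> (int \<Rightarrow> 'b) \<Rightarrow> (int \<Rightarrow> 'b) set" where
  "followers Y y = {z. glue 0 y z \<in> Y}"

text \<open>The single constant \<open>L\<close> bounds both the radius of the code and the overlap needed for gluing in
  \<open>X\<close>; taking the larger of the two makes images of glued points glued images (\<open>code_glue\<close>).\<close>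

locale right_continuing_finite_type =
  fixes A :: "'a set" and X :: "(int \<Rightarrow> 'a) set"
    and B :: "'b set" and Y :: "(int \<Rightarrow> 'b) set"
    and \<phi> :: "(int \<Rightarrow> 'a) \<Rightarrow> (int \<Rightarrow> 'b)" and L :: int
  assumes X: "shift_space A X" and Y: "shift_space B Y"
    and rc: "right_continuing A X B Y \<phi>"
    and L_nonneg: "0 \<le> L"
    and radius: "\<And>x y i. x \<in> X \<Longrightarrow> y \<in> X \<Longrightarrow>
      (\<And>j. i - L \<le> j \<Longrightarrow> j \<le> i + L \<Longrightarrow> x j = y j) \<Longrightarrow> \<phi> x i = \<phi> y i"
    and gluing: "\<And>x y p. x \<in> X \<Longrightarrow> y \<in> X \<Longrightarrow>
      (\<And>j. p - L \<le> j \<Longrightarrow> j \<le> p + L \<Longrightarrow> x j = y j) \<Longrightarrow> glue p x y \<in> X"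
begin

lemma onto: "\<phi> ` X = Y"
  using rc by (simp add: right_continuing_def)

lemma code_glue:
  assumes "x \<in> X" "y \<in> X" and ag: "\<And>j. p - L \<le> j \<Longrightarrow> j \<le> p + L \<Longrightarrow> x j = y j"
  shows "\<phi> (glue p x y) = glue p (\<phi> x) (\<phi> y)"
proof
  fix i
  have g: "glue p x y \<in> X" using gluing assms by blast
  show "\<phi> (glue p x y) i = glue p (\<phi> x) (\<phi> y) i"
  proof (cases "i \<le> p")
    case True
    have "\<phi> (glue p x y) i = \<phi> x i"
      using ag True by (intro radius g assms(1)) (auto simp: glue_def)
    then show ?thesis using True by (simp add: glue_def)
  next
    case False
    have "\<phi> (glue p x y) i = \<phi> y i"
      using ag False by (intro radius g assms(2)) (auto simp: glue_def)
    then show ?thesis using False by (simp add: glue_def)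
  qed
qed

text \<open>The central word plays the part of the vertex at the origin in a graph presentation of \<open>X\<close>.\<close>

definition state :: "(int \<Rightarrow> 'a) \<Rightarrow> (int \<Rightarrow> 'a)" where
  "state x = restrict x {-L..L}"

lemma state_eq: "state x = state y \<longleftrightarrow> agree L x y"
  by (auto simp: state_def agree_def restrict_def fun_eq_iff split: if_splits)

lemma finite_states: "finite (state ` X)"
proof (rule finite_subset)
  show "state ` X \<subseteq> PiE {-L..L} (\<lambda>_. A)"
    using shift_space_alphabet[OF X] by (auto simp: state_def)
  show "finite (PiE {-L..L} (\<lambda>_. A))"
    using X by (intro finite_PiE) (auto simp: shift_space_def)
qed

text \<open>The lift of a point with past \<open>y\<close> shows one inclusion. Conversely a lift of the past and a
  lift of the future with the same state can be glued at the origin, and their images with them.\<close>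

lemma followers_via_states:
  "followers Y y = (\<Union>s \<in> state ` {x \<in> X. \<forall>i\<le>0. \<phi> x i = y i}.
     {z. \<exists>x\<in>X. state x = s \<and> (\<forall>i>0. \<phi> x i = z i)})" (is "_ = ?R")
proof (intro equalityI subsetI)
  fix z assume "z \<in> followers Y y"
  then obtain x where x: "x \<in> X" "glue 0 y z = \<phi> x"
    using onto by (auto simp: followers_def)
  from x(2)[symmetric] have "\<forall>i\<le>0. \<phi> x i = y i" "\<forall>i>0. \<phi> x i = z i"
    by (simp_all add: glue_def)
  then show "z \<in> ?R" using x by blast
next
  fix z assume "z \<in> ?R"
  then obtain x u where x: "x \<in> X" "\<And>i. i \<le> 0 \<Longrightarrow> \<phi> x i = y i"
    and u: "u \<in> X" "state u = state x" "\<And>i. 0 < i \<Longrightarrow> \<phi> u i = z i" by auto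
  have ag: "x j = u j" if "0 - L \<le> j" "j \<le> 0 + L" for j
    using u(2) that by (auto simp: state_eq agree_def)
  have "\<phi> (glue 0 x u) = glue 0 y z"
    using code_glue[OF x(1) u(1) ag] x(2) u(3) by (auto simp: glue_def fun_eq_iff)
  then show "z \<in> followers Y y"
    using onto imageI[OF gluing[OF x(1) u(1) ag, of 0], of \<phi>] by (simp add: followers_def)
qed

lemma finite_followers: "finite (range (followers Y))"
proof (rule finite_subset)
  define G where "G T = (\<Union>s\<in>T. {z. \<exists>x\<in>X. state x = s \<and> (\<forall>i>0. \<phi> x i = z i)})" for T
  have "followers Y y = G (state ` {x \<in> X. \<forall>i\<le>0. \<phi> x i = y i})" for y
    unfolding G_def by (rule followers_via_states)
  then show "range (followers Y) \<subseteq> G ` Pow (state ` X)" by auto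
  show "finite (G ` Pow (state ` X))"
    using finite_states by blast
qed

text \<open>If a follower set occurs arbitrarily near \<open>y\<close>, closedness of \<open>Y\<close> puts all its elements into
  \<open>followers Y y\<close>. Each of the finitely many follower sets not contained in \<open>followers Y y\<close> therefore
  stays away from \<open>y\<close>.\<close>

lemma followers_upper:
  assumes y: "y \<in> Y"
  obtains N where "\<And>y'. y' \<in> Y \<Longrightarrow> agree N y y' \<Longrightarrow> followers Y y' \<subseteq> followers Y y"
proof -
  define \<C> where "\<C> = {c \<in> followers Y ` Y. \<not> c \<subseteq> followers Y y}"
  have fin: "finite \<C>"
    unfolding \<C>_def using finite_followers by (auto intro: finite_subset[rotated])
  have "\<exists>n. \<forall>y'\<in>Y. followers Y y' = c \<longrightarrow> \<not> agree n y y'" if c: "c \<in> \<C>" for c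
  proof (rule ccontr)
    assume "\<not> ?thesis"
    then have app: "\<exists>y'\<in>Y. followers Y y' = c \<and> agree n y y'" for n by blast
    obtain z where z: "z \<in> c" "z \<notin> followers Y y" using c by (auto simp: \<C>_def)
    have app': "\<exists>v\<in>Y. agree n (glue 0 y z) v" for n
    proof -
      obtain y' where "followers Y y' = c" "agree n y y'" using app by blast
      then show ?thesis using z(1)
        by (intro bexI[of _ "glue 0 y' z"]) (auto simp: followers_def agree_def glue_def)
    qed
    have "glue 0 y z i \<in> B" for i
    proof -
      obtain v where "v \<in> Y" "agree \<bar>i\<bar> (glue 0 y z) v" using app' by blast
      moreover from this have "glue 0 y z i = v i" unfolding agree_def by (rule_tac bspec) auto
      ultimately show ?thesis using shift_space_alphabet[OF Y, of v i] by simp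
    qed
    then have "glue 0 y z \<in> Y"
      using shift_space_limit[OF Y _ app'] by blast
    then show False using z(2) by (simp add: followers_def)
  qed
  then have "\<forall>c\<in>\<C>. \<exists>n. \<forall>y'\<in>Y. followers Y y' = c \<longrightarrow> \<not> agree n y y'" by blast
  then obtain n where "\<forall>c\<in>\<C>. \<forall>y'\<in>Y. followers Y y' = c \<longrightarrow> \<not> agree (n c) y y'"
    by (rule bchoice[THEN exE])
  then have n: "\<not> agree (n (followers Y y')) y y'" if "y' \<in> Y" "followers Y y' \<in> \<C>" for y'
    using that by blast
  define N where "N = Max (insert 0 (n ` \<C>))"
  have N: "n c \<le> N" if "c \<in> \<C>" for c
    unfolding N_def using fin that by (intro Max_ge) auto
  have "followers Y y' \<subseteq> followers Y y" if y': "y' \<in> Y" "agree N y y'" for y'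
  proof (rule ccontr)
    assume "\<not> ?thesis"
    then have "followers Y y' \<in> \<C>" using y' by (auto simp: \<C>_def)
    then show False using n N y' agree_mono by metis
  qed
  then show ?thesis using that by blast
qed

text \<open>Right continuation lifts each follower of \<open>\<phi> x\<close> to a point of the set \<open>U\<close> below. One representative
  \<open>u\<close> in \<open>U\<close> for each state at the origin suffices, and finitely many representatives coincide with
  \<open>x\<close> up to a common place \<open>-m\<close>. If \<open>x'\<close> agrees with \<open>x\<close> on a window reaching far enough to the left
  of \<open>-m\<close>, then \<open>x'\<close> can be continued by \<open>u\<close>; the result still maps to the past of \<open>\<phi> x'\<close> and
  reaches the same state as the lift.\<close>

lemma followers_lower:
  assumes x: "x \<in> X"
  obtains N where "\<And>x'. x' \<in> X \<Longrightarrow> agree N x x' \<Longrightarrow> followers Y (\<phi> x) \<subseteq> followers Y (\<phi> x')"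
proof -
  define U where "U = {u \<in> X. left_asymptotic u x \<and> (\<forall>i\<le>0. \<phi> u i = \<phi> x i)}"
  have "finite (state ` U)"
    using finite_states by (rule finite_subset[rotated]) (auto simp: U_def)
  then obtain D where D: "finite D" "D \<subseteq> U" "state ` U = state ` D"
    by (metis finite_subset_image order_refl)
  have "\<exists>n. \<forall>i\<le>-n. u i = x i" if u: "u \<in> D" for u
  proof -
    obtain k where "\<forall>i\<le>k. u i = x i"
      using subsetD[OF D(2) u] by (auto simp: U_def left_asymptotic_def)
    then show ?thesis by (intro exI[of _ "-k"]) simp
  qed
  then have "\<forall>u\<in>D. \<exists>n. \<forall>i\<le>-n. u i = x i" by blast
  then obtain n where "\<forall>u\<in>D. \<forall>i\<le>- n u. u i = x i" by (rule bchoice[THEN exE])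
  then have n: "u i = x i" if "u \<in> D" "i \<le> - n u" for u i using that by blast
  define m where "m = Max (insert 0 (n ` D))"
  have m: "n u \<le> m" if "u \<in> D" for u
    unfolding m_def using D(1) that by (intro Max_ge) auto
  have m0: "0 \<le> m" unfolding m_def using D(1) by (intro Max_ge) auto
  \<comment> \<open>The overlap needed for gluing at \<open>p\<close> ends at \<open>-m\<close> and begins at \<open>-(m + 2 * L)\<close>.\<close>
  define p where "p = - m - L"
  have "followers Y (\<phi> x) \<subseteq> followers Y (\<phi> x')" if x': "x' \<in> X" "agree (m + 2 * L) x x'" for x'
  proof
    fix z assume z: "z \<in> followers Y (\<phi> x)"
    then have "glue 0 (\<phi> x) z \<in> Y" by (simp add: followers_def)
    moreover have "left_asymptotic (\<phi> x) (glue 0 (\<phi> x) z)"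
      by (auto simp: left_asymptotic_def glue_def)
    ultimately obtain v where v: "v \<in> X" "left_asymptotic v x" "\<phi> v = glue 0 (\<phi> x) z"
      using rc x unfolding right_continuing_def by blast
    then have "v \<in> U" by (simp add: U_def glue_def)
    then obtain u where u: "u \<in> D" "state v = state u" using D(3) by (metis image_iff)
    have uX: "u \<in> X" and u\<phi>: "\<And>i. i \<le> 0 \<Longrightarrow> \<phi> u i = \<phi> x i"
      using u(1) D(2) by (auto simp: U_def)
    have ag: "x' j = u j" if "p - L \<le> j" "j \<le> p + L" for j
      using that n[OF u(1), of j] m[OF u(1)] x'(2) m0 L_nonneg by (auto simp: agree_def p_def)
    define w where "w = glue p x' u"
    have w: "w \<in> X" "\<phi> w = glue p (\<phi> x') (\<phi> u)"
      unfolding w_def using gluing[OF x'(1) uX ag] code_glue[OF x'(1) uX ag] by auto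
    have "\<phi> w i = \<phi> x' i" if "i \<le> 0" for i
    proof (cases "i \<le> p")
      case False
      \<comment> \<open>Between the cut and the origin, \<open>u\<close> has the image of \<open>x\<close>, and \<open>x'\<close> is still close to \<open>x\<close>.\<close>
      have "\<phi> x i = \<phi> x' i"
        using False that x'(2) m0 L_nonneg
        by (intro radius x x'(1)) (auto simp: agree_def p_def)
      then show ?thesis using False that u\<phi> by (simp add: w(2) glue_def)
    qed (simp add: w(2) glue_def)
    moreover have "state v = state w"
    proof -
      have "w i = u i" if "-L \<le> i" for i
        using that ag[of i] m0 L_nonneg by (auto simp: w_def glue_def p_def)
      then show ?thesis unfolding u(2) state_eq by (simp add: agree_def)
    qed
    moreover have "\<forall>i>0. \<phi> v i = z i" using v(3) by (simp add: glue_def)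
    ultimately show "z \<in> followers Y (\<phi> x')"
      unfolding followers_via_states using v(1) w(1) by blast
  qed
  then show ?thesis using that by blast
qed

lemma followers_code_locally_constant: "locally_constant X (followers Y \<circ> \<phi>)"
  unfolding locally_constant_def
proof
  fix x assume x: "x \<in> X"
  obtain M where M: "\<And>y. y \<in> Y \<Longrightarrow> agree M (\<phi> x) y \<Longrightarrow> followers Y y \<subseteq> followers Y (\<phi> x)"
    using followers_upper x onto by blast
  obtain N where N: "\<And>x'. x' \<in> X \<Longrightarrow> agree N x x' \<Longrightarrow> followers Y (\<phi> x) \<subseteq> followers Y (\<phi> x')"
    using followers_lower x by blast
  have "followers Y (\<phi> x') = followers Y (\<phi> x)"
    if x': "x' \<in> X" "agree (max (M + L) N) x x'" for x'
  proof
    have "x j = x' j" if "\<bar>j\<bar> \<le> M + L" for j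
      using agree_mono[OF x'(2), of "M + L"] that by (auto simp: agree_def abs_le_iff)
    then have "agree M (\<phi> x) (\<phi> x')"
      unfolding agree_def using x'(1) x by (intro ballI radius) auto
    then show "followers Y (\<phi> x') \<subseteq> followers Y (\<phi> x)" using M x' onto by blast
    show "followers Y (\<phi> x) \<subseteq> followers Y (\<phi> x')" using N x' agree_mono by (meson max.cobounded2)
  qed
  then show "\<exists>N. \<forall>y\<in>X. agree N x y \<longrightarrow> (followers Y \<circ> \<phi>) y = (followers Y \<circ> \<phi>) x"
    by (metis comp_apply)
qed

lemma image_finite_type: "shift_of_finite_type B Y"
proof -
  have "locally_constant Y (followers Y)"
    using locally_constant_push_forward[OF X Y _ onto followers_code_locally_constant] rc
    by (simp add: right_continuing_def block_code_def)
  then obtain N where N: "0 \<le> N"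
    "\<And>y z. y \<in> Y \<Longrightarrow> z \<in> Y \<Longrightarrow> agree N y z \<Longrightarrow> followers Y y = followers Y z"
    using locally_constant_uniform[OF Y] by metis
  show ?thesis
  proof (rule finite_type_if_gluing[OF Y N(1)])
    fix y z assume yz: "y \<in> Y" "z \<in> Y" "agree N y z"
    \<comment> \<open>Every point follows its own past.\<close>
    have "z \<in> followers Y z" using yz by (simp add: followers_def glue_def)
    then have "z \<in> followers Y y" using N(2)[OF yz] by simp
    then show "glue 0 y z \<in> Y" by (simp add: followers_def)
  qed
qed

end

theorem theorem5p1:
  fixes A :: "'a set" and X :: "(int \<Rightarrow> 'a) set"
    and B :: "'b set" and Y :: "(int \<Rightarrow> 'b) set"
    and \<phi> :: "(int \<Rightarrow> 'a) \<Rightarrow> (int \<Rightarrow> 'b)"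
  assumes "shift_of_finite_type A X"
    and "shift_space B Y"
    and "right_continuing A X B Y \<phi>"
  shows "shift_of_finite_type B Y"
proof -
  have X: "shift_space A X" using assms(1) by (simp add: shift_of_finite_type_def)
  have c: "block_code A X B Y \<phi>" using assms(3) by (simp add: right_continuing_def)
  obtain M where M: "0 \<le> M"
    "\<And>x y p. x \<in> X \<Longrightarrow> y \<in> X \<Longrightarrow> (\<And>j. p - M \<le> j \<Longrightarrow> j \<le> p + M \<Longrightarrow> x j = y j) \<Longrightarrow> glue p x y \<in> X"
    using finite_type_gluing[OF assms(1)] by blast
  obtain R where R: "0 \<le> R"
    "\<And>x y i. x \<in> X \<Longrightarrow> y \<in> X \<Longrightarrow> (\<And>j. i - R \<le> j \<Longrightarrow> j \<le> i + R \<Longrightarrow> x j = y j) \<Longrightarrow> \<phi> x i = \<phi> y i"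
    using block_code_radius[OF X assms(2) c] by blast
  interpret right_continuing_finite_type A X B Y \<phi> "max M R"
  proof
    show "\<phi> x i = \<phi> y i" if "x \<in> X" "y \<in> X"
      "\<And>j. i - max M R \<le> j \<Longrightarrow> j \<le> i + max M R \<Longrightarrow> x j = y j" for x y i
      using that by (intro R(2)) auto
    show "glue p x y \<in> X" if "x \<in> X" "y \<in> X"
      "\<And>j. p - max M R \<le> j \<Longrightarrow> j \<le> p + max M R \<Longrightarrow> x j = y j" for x y p
      using that by (intro M(2)) auto
    show "0 \<le> max M R" using M(1) by simp
  qed (fact X assms(2,3))+
  show ?thesis by (rule image_finite_type)
qed

end
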